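(* If $G$ is a $2$-connected partial $2$-tree that contains an $n$-vertex path, then $G$ contains an induced path of size $\frac{\log (n-3)}{2}$.
   Context: The class of $k$-trees is defined recursively: any clique on $k$ vertices is a $k$-tree; and if $G$ has a vertex $v$ whose neighborhood is a clique of size exactly $k$ and $G\setminus v$ is a $k$-tree, then $G$ is a $k$-tree. A partial $k$-tree is any subgraph of a $k$-tree. The size of a path is its number of vertices. Logarithms are base 2. *)

theory Defs
  imports Complex_Main "Graph_Theory.Graph_Theory"
begin

text \<open>
  A finite simple undirected graph is a \<open>pair_graph\<close>: a finite loop-free pair digraph with a
  symmetric arc relation, each edge being the two opposite arcs.
\<close>

definition neighborhood :: "'a pair_pre_digraph \<Rightarrow> 'a \<Rightarrow> 'a set" where
  "neighborhood G v = {u. (v, u) \<in> parcs G}"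

definition induced_pair :: "'a pair_pre_digraph \<Rightarrow> 'a set \<Rightarrow> 'a pair_pre_digraph" where
  "induced_pair G S = \<lparr> pverts = pverts G \<inter> S, parcs = parcs G \<inter> S \<times> S \<rparr>"

lemma (in pair_wf_digraph) with_proj_induced_pair:
  "with_proj (induced_pair G S) = with_proj G \<restriction> (pverts G \<inter> S)"
  by (auto simp: with_proj_def induced_pair_def induce_subgraph_def
           dest: arc_fst_in_verts arc_snd_in_verts)

inductive k_tree :: "nat \<Rightarrow> 'a pair_pre_digraph \<Rightarrow> bool" for k where
  clique: "complete_digraph k (with_proj G) \<Longrightarrow> k_tree k G"
| extend: "\<lbrakk>pair_graph G; v \<in> pverts G;
            complete_digraph k (with_proj (induced_pair G (neighborhood G v)));
            k_tree k (induced_pair G (- {v}))\<rbrakk> \<Longrightarrow> k_tree k G"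

text \<open>
  The host \<open>k\<close>-tree may need vertices outside \<open>G\<close>, and the vertex type of \<open>G\<close> may be finite.
  Every \<open>k\<close>-tree is finite, hence isomorphic to one whose vertices are natural numbers, so
  ``subgraph of a \<open>k\<close>-tree'' is read up to isomorphism with the host on \<open>nat\<close>.
\<close>

definition partial_k_tree :: "nat \<Rightarrow> 'a pair_pre_digraph \<Rightarrow> bool" where
  "partial_k_tree k G \<longleftrightarrow>
     pair_graph G \<and>
     (\<exists>(T :: nat pair_pre_digraph) (H :: nat pair_pre_digraph).
        k_tree k T \<and> subgraph (with_proj H) (with_proj T) \<and>
        digraph_iso (with_proj G) (with_proj H))"

definition k_connected :: "nat \<Rightarrow> 'a pair_pre_digraph \<Rightarrow> bool" where
  "k_connected k G \<longleftrightarrow>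
     k < card (pverts G) \<and>
     (\<forall>X. X \<subseteq> pverts G \<and> card X < k \<longrightarrow> connected (with_proj (induced_pair G (- X))))"

definition induced_vpath :: "'a vwalk \<Rightarrow> 'a pair_pre_digraph \<Rightarrow> bool" where
  "induced_vpath p G \<longleftrightarrow>
     vpath p (with_proj G) \<and>
     parcs (induced_pair G (set p)) = set (vwalk_arcs p) \<union> (set (vwalk_arcs p))\<inverse>"

end

theory Submission
  imports Defs
begin

text \<open>
  Let \<open>M\<close> be the maximal length of a cycle of \<open>G\<close>. By 2-connectivity the ends of the given path lie
  on a common cycle \<open>C\<close>. A subpath joining two vertices of \<open>C\<close> and otherwise avoiding \<open>C\<close> can
  replace either of the two arcs of \<open>C\<close> between them, so it has at most \<open>M - |C|/2\<close> edges; as the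
  path meets \<open>C\<close> at most \<open>|C|\<close> times, this yields \<open>2 (n - 1) \<le> M (M - 1)\<close>.

  Treewidth two means that chords of a cycle never cross: in a crossing pair every end of a chord
  has degree at least three, so a degree-two vertex of the host 2-tree can be bypassed.

  On a cycle of length \<open>M\<close> without crossing chords there is a pair \<open>x, z\<close> separated by no chord and
  splitting the cycle into arcs with between \<open>M/3\<close> and \<open>2M/3\<close> edges. Descending into the larger half
  of an arc with \<open>l\<close> edges, one finds induced paths starting at its two ends with \<open>log l\<close> edges in
  total. Gluing these at \<open>x\<close> and at \<open>z\<close> gives an induced path with \<open>s\<close> vertices, where
  \<open>4\<^sup>s \<ge> 4 (M/3) (2M/3)\<close>.
\<close>

text \<open>Rings are cycles, except that a single edge also counts as a ring, of length two.\<close>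

definition ring :: "('a \<Rightarrow> 'a \<Rightarrow> bool) \<Rightarrow> 'a list \<Rightarrow> bool" where
  "ring E c \<longleftrightarrow> 2 \<le> length c \<and> distinct c \<and> successively E c \<and> E (last c) (hd c)"

text \<open>Whether two chords of a cycle cross does not depend on where the cycle is cut open. For
  symmetric \<open>E\<close> this linear pattern therefore serves both whole rings and their
  segments.\<close>

definition crossing_free :: "('a \<Rightarrow> 'a \<Rightarrow> bool) \<Rightarrow> 'a list \<Rightarrow> bool" where
  "crossing_free E w \<longleftrightarrow>
     (\<forall>p a xs b ys c zs d ws. w = p @ a # xs @ b # ys @ c # zs @ d # ws \<longrightarrow> \<not> (E a c \<and> E b d))"

lemma ring_mono:
  assumes "ring E c" and "\<And>x y. \<lbrakk>x \<in> set c; y \<in> set c; E x y\<rbrakk> \<Longrightarrow> F x y"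
  shows "ring F c"
proof -
  have "c \<noteq> []" using assms(1) by (auto simp: ring_def)
  then show ?thesis
    using assms successively_mono[of E c F] by (simp add: ring_def)
qed

section \<open>Induced paths as lists over a symmetric relation\<close>

locale symmetric_relation =
  fixes E :: "'a \<Rightarrow> 'a \<Rightarrow> bool"
  assumes E_sym: "E x y \<Longrightarrow> E y x"
begin

text \<open>These are the induced paths, up to loops at their vertices. The recursion follows the
  way such paths are extended, by prepending a vertex.\<close>

fun chordless :: "'a list \<Rightarrow> bool" where
  "chordless [] \<longleftrightarrow> True"
| "chordless [x] \<longleftrightarrow> True"
| "chordless (x # y # q) \<longleftrightarrow>
     E x y \<and> x \<notin> set (y # q) \<and> (\<forall>z\<in>set q. \<not> E x z) \<and> chordless (y # q)"

lemma chordless_ConsD: "chordless (x # q) \<Longrightarrow> chordless q"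
  by (cases q) auto

lemma chordless_appendD: "chordless (p @ q) \<Longrightarrow> chordless q"
  by (induction p) (auto dest: chordless_ConsD)

lemma chordless_distinct: "chordless p \<Longrightarrow> distinct p"
  by (induction p rule: chordless.induct) auto

lemma chordless_successively: "chordless p \<Longrightarrow> successively E p"
  by (induction p rule: chordless.induct) auto

lemma chordless_join:
  assumes "chordless (p @ [u])" "chordless (u # q)"
    and "set p \<inter> set q = {}" "\<And>x y. x \<in> set p \<Longrightarrow> y \<in> set q \<Longrightarrow> \<not> E x y"
  shows "chordless (p @ u # q)"
  using assms
proof (induction p)
  case (Cons x p)
  then show ?case
    by (cases p) (auto dest: chordless_ConsD)
qed simp

lemma chordless_rev: "chordless p \<Longrightarrow> chordless (rev p)"
proof (induction p rule: chordless.induct)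
  case (3 x y q)
  then have "chordless (rev q @ [y])" "chordless [y, x]" using E_sym by auto
  then show ?case
    using chordless_join[of "rev q" y "[x]"] 3 E_sym by auto
qed auto

lemma chordless_arcs:
  assumes "chordless p" "x \<in> set p" "y \<in> set p" "E x y" "x \<noteq> y"
  shows "(x, y) \<in> set (vwalk_arcs p) \<or> (y, x) \<in> set (vwalk_arcs p)"
  using assms by (induction p rule: chordless.induct) (auto dest: E_sym)

text \<open>Shorten the tail first. If \<open>x\<close> already lies on the result, cut there;
  otherwise jump from \<open>x\<close> to its last neighbour on the result, past which
  \<open>x\<close> has no neighbours.\<close>

lemma chordless_shortcut:
  assumes "successively E p" "p \<noteq> []"
  shows "\<exists>q. chordless q \<and> q \<noteq> [] \<and> hd q = hd p \<and> last q = last p \<and> set q \<subseteq> set p"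
  using assms
proof (induction p)
  case (Cons x p)
  show ?case
  proof (cases "p = []")
    case True
    then show ?thesis by (intro exI[of _ "[x]"]) auto
  next
    case False
    then obtain q where q: "chordless q" "q \<noteq> []" "hd q = hd p" "last q = last p" "set q \<subseteq> set p"
      using Cons by (auto simp: successively_Cons)
    show ?thesis
    proof (cases "x \<in> set q")
      case True
      then obtain as bs where "q = as @ x # bs" by (auto dest: split_list)
      then show ?thesis using q False
        by (intro exI[of _ "x # bs"]) (auto dest: chordless_appendD)
    next
      case nin: False
      have "\<exists>z\<in>set q. E x z"
        using q Cons.prems False by (metis hd_in_set successively_Cons)
      from split_list_last_prop[OF this]
      obtain as z bs where s: "q = as @ z # bs" "E x z" "\<forall>y\<in>set bs. \<not> E x y" by blast
      have "chordless (z # bs)" using s(1) q(1) chordless_appendD by blast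
      then show ?thesis using q False s nin
        by (intro exI[of _ "x # z # bs"]) auto
    qed
  qed
qed simp

lemma ring_rotate: "ring E (p @ q) \<Longrightarrow> ring E (q @ p)"
  by (cases "p = []"; cases "q = []") (auto simp: ring_def successively_append_iff)

section \<open>Long induced paths on rings without crossing chords\<close>

lemma crossing_free_infix: "crossing_free E (p @ q @ r) \<Longrightarrow> crossing_free E q"
  unfolding crossing_free_def by (metis append.assoc append_Cons)

lemma crossing_freeD:
  assumes "crossing_free E (p @ x # as @ u # bs)" "E x u" "y \<in> set as" "v \<in> set bs"
  shows "\<not> E y v"
proof -
  obtain a1 a2 b1 b2 where "as = a1 @ y # a2" "bs = b1 @ v # b2"
    using assms by (meson split_list)
  then have "p @ x # as @ u # bs = p @ x # a1 @ y # a2 @ u # b1 @ v # b2" by simp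
  then show ?thesis using assms(1,2) unfolding crossing_free_def by blast
qed

text \<open>Let \<open>u\<close> be the last neighbour of \<open>x\<close> inside the arc. No edge
  leads from strictly between \<open>x\<close> and \<open>u\<close> to beyond \<open>u\<close>,
  since it would cross \<open>x u\<close>. Recursing into the larger side at most halves the number
  of edges, and in return \<open>u\<close> is added to one of the two wings. \<open>A\<close> and
  \<open>B\<close> may share vertices: a glued path takes only one wing from each arc.\<close>

lemma wings:
  assumes "distinct (x # ys @ [z])" "successively E (x # ys @ [z])" "crossing_free E (x # ys @ [z])"
  shows "\<exists>A B. chordless (x # A) \<and> chordless (z # B) \<and> set A \<subseteq> set ys \<and> set B \<subseteq> set ys \<and>
           Suc (length ys) \<le> 2 ^ (length A + length B)"
  using assms
proof (induction "length ys" arbitrary: x ys z rule: less_induct)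
  case less
  show ?case
  proof (cases "ys = []")
    case True
    then show ?thesis by (intro exI[of _ "[]"]) auto
  next
    case False
    then have "\<exists>u\<in>set ys. E x u"
      using less.prems(2) by (cases ys) auto
    from split_list_last_prop[OF this]
    obtain as u bs where ys: "ys = as @ u # bs" and xu: "E x u" and no: "\<forall>y\<in>set bs. \<not> E x y"
      by blast
    have cross: "\<not> E y v" if "y \<in> set as" "v \<in> set (bs @ [z])" for y v
      using crossing_freeD[of "[]" x as u "bs @ [z]"] less.prems(3) xu that by (auto simp: ys)
    show ?thesis
    proof (cases "length bs \<le> length as")
      case True
      have "crossing_free E (x # as @ [u])"
        using crossing_free_infix[of "[]" "x # as @ [u]" "bs @ [z]"] less.prems(3) by (simp add: ys)
      moreover have "successively E (x # as @ [u])"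
        using less.prems(2) by (simp add: ys successively_append_iff successively_Cons hd_append split: if_splits)
      ultimately obtain A B where AB: "chordless (x # A)" "chordless (u # B)" "set A \<subseteq> set as"
        "set B \<subseteq> set as" "Suc (length as) \<le> 2 ^ (length A + length B)"
        using less.hyps[of as x u] less.prems(1) by (auto simp: ys)
      have "successively E (u # bs @ [z])"
        using less.prems(2) by (simp add: ys successively_append_iff successively_Cons hd_append split: if_splits)
      then have "successively E (rev (u # bs @ [z]))"
        unfolding successively_rev by (rule successively_mono) (auto dest: E_sym)
      from chordless_shortcut[OF this]
      \<comment> \<open>The wing of \<open>z\<close> first travels through \<open>bs\<close> to
        \<open>u\<close> and then follows the recursive wing \<open>B\<close> inside
        \<open>as\<close>. It gains at least the vertex \<open>u\<close>, which pays for the factor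
        2.\<close>
      obtain q where q: "chordless q" "q \<noteq> []" "hd q = z" "last q = u" "set q \<subseteq> set (u # bs @ [z])"
        by auto
      obtain r where r: "q = r @ [u]" using q(2,4) by (metis append_butlast_last_id)
      have "r \<noteq> []" using q(3) r less.prems(1) ys by auto
      then obtain r' where r': "r = z # r'" using q(3) r by (cases r) auto
      have dq: "distinct (z # r' @ [u])" using chordless_distinct[OF q(1)] r r' by simp
      then have r'bs: "set r' \<subseteq> set bs" using q(5) r r' by auto
      have "chordless (r @ u # B)"
      proof (rule chordless_join)
        show "chordless (r @ [u])" "chordless (u # B)" using q r AB by auto
        show "set r \<inter> set B = {}" using r' r'bs AB(4) less.prems(1) ys by auto
        show "\<not> E a b" if "a \<in> set r" "b \<in> set B" for a b
          using cross[of b a] that r' r'bs AB(4) by (auto dest: E_sym)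
      qed
      then have "chordless (z # (r' @ u # B))" using r' by simp
      moreover have "Suc (length ys) \<le> 2 ^ (length A + length (r' @ u # B))"
      proof -
        have "Suc (length ys) \<le> 2 * Suc (length as)" using True ys by simp
        also have "\<dots> \<le> 2 ^ Suc (length A + length B)" using AB(5) by simp
        also have "\<dots> \<le> 2 ^ (length A + length (r' @ u # B))"
          by (rule power_increasing) auto
        finally show ?thesis .
      qed
      ultimately show ?thesis using AB r'bs ys
        by (intro exI[of _ A] exI[of _ "r' @ u # B"]) auto
    next
      case False
      have "crossing_free E (u # bs @ [z])"
        using crossing_free_infix[of "x # as" "u # bs @ [z]" "[]"] less.prems(3) by (simp add: ys)
      moreover have "successively E (u # bs @ [z])"
        using less.prems(2) by (simp add: ys successively_append_iff successively_Cons hd_append split: if_splits)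
      ultimately obtain A B where AB: "chordless (u # A)" "chordless (z # B)" "set A \<subseteq> set bs"
        "set B \<subseteq> set bs" "Suc (length bs) \<le> 2 ^ (length A + length B)"
        using less.hyps[of bs u z] less.prems(1) by (auto simp: ys)
      \<comment> \<open>\<open>A\<close> stays beyond \<open>u\<close>, where \<open>x\<close> has
        no neighbours.\<close>
      have "chordless (x # u # A)"
        using AB(1,3) xu no less.prems(1) ys by auto
      moreover have "Suc (length ys) \<le> 2 * Suc (length bs)" using False ys by simp
      then have "Suc (length ys) \<le> 2 ^ (length (u # A) + length B)" using AB(5) by simp
      ultimately show ?thesis using AB ys
        by (intro exI[of _ "u # A"] exI[of _ B]) auto
    qed
  qed
qed

text \<open>Take a shortest arc from \<open>x\<close> to \<open>z\<close> that has at least a third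
  of the edges and whose interior sends no edge to the interior of the other arc. If it had more
  than two thirds, the last neighbour \<open>u\<close> of \<open>x\<close> inside it would split it;
  the larger part has more than a third of the edges, and its interior is still separated from the
  rest, contradicting minimality.\<close>

lemma ring_balanced_split:
  assumes "ring E c" and cf: "\<And>c. ring E c \<Longrightarrow> crossing_free E c"
  shows "\<exists>x ys z ws. ring E (x # ys @ z # ws) \<and> set (x # ys @ z # ws) = set c \<and>
           length (x # ys @ z # ws) = length c \<and>
           length c \<le> 3 * Suc (length ys) \<and> 3 * Suc (length ys) \<le> 2 * length c \<and>
           (\<forall>y\<in>set ys. \<forall>w\<in>set ws. \<not> E y w)"
proof -
  define good where "good k \<longleftrightarrow> (\<exists>x ys z ws. ring E (x # ys @ z # ws) \<and>
    set (x # ys @ z # ws) = set c \<and> length (x # ys @ z # ws) = length c \<and> length c \<le> 3 * Suc (length ys) \<and>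
    (\<forall>y\<in>set ys. \<forall>w\<in>set ws. \<not> E y w) \<and> k = length ys)" for k
  obtain x ys z where c: "c = x # ys @ [z]"
    using assms(1) unfolding ring_def
    by (metis One_nat_def Suc_1 Suc_n_not_le_n append_butlast_last_id length_Cons list.size(3)
        list.exhaust not_less_eq_eq zero_le)
  \<comment> \<open>The ring cut at its closing edge is a first candidate, with an empty opposite
    arc.\<close>
  then have "good (length ys)"
    unfolding good_def using assms(1) by (intro exI[of _ x] exI[of _ ys] exI[of _ z] exI[of _ "[]"]) auto
  then obtain k where k: "good k" and min: "\<And>j. j < k \<Longrightarrow> \<not> good j"
    by (metis LeastI not_less_Least)
  from k obtain x ys z ws where r: "ring E (x # ys @ z # ws)"
    and set_c: "set (x # ys @ z # ws) = set c"
    and len: "length (x # ys @ z # ws) = length c" "length c \<le> 3 * Suc (length ys)"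
    and sep: "\<forall>y\<in>set ys. \<forall>w\<in>set ws. \<not> E y w" and kl: "k = length ys"
    unfolding good_def by blast
  have "3 * Suc (length ys) \<le> 2 * length c"
  proof (rule ccontr)
    assume big: "\<not> ?thesis"
    have "ys \<noteq> []" using big len by auto
    then have "\<exists>u\<in>set ys. E x u"
      using r by (cases ys) (auto simp: ring_def)
    from split_list_last_prop[OF this]
    obtain as u bs where ys: "ys = as @ u # bs" and xu: "E x u" and no: "\<forall>y\<in>set bs. \<not> E x y"
      by blast
    have cross: "\<not> E y v" if "y \<in> set as" "v \<in> set (bs @ z # ws)" for y v
      using crossing_freeD[of "[]" x as u "bs @ z # ws"] cf[OF r] xu that by (auto simp: ys)
    show False
    proof (cases "length bs \<le> length as")
      case True
      have "ring E (x # as @ u # bs @ z # ws)" using r ys by simp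
      then have "good (length as)" unfolding good_def
        using True big len cross ys set_c
        by (intro exI[of _ x] exI[of _ as] exI[of _ u] exI[of _ "bs @ z # ws"]) auto
      then show False using min kl ys by auto
    next
      case False
      have "ring E (u # bs @ z # ws @ x # as)"
        using ring_rotate[of "x # as" "u # bs @ z # ws"] r ys by simp
      then have "good (length bs)" unfolding good_def
        using False big len cross ys sep no set_c
        by (intro exI[of _ u] exI[of _ bs] exI[of _ z] exI[of _ "ws @ x # as"]) (auto dest: E_sym)
      then show False using min kl ys by auto
    qed
  qed
  then show ?thesis using r set_c len sep by blast
qed

lemma ring_chordless_path:
  assumes "ring E c" and cf: "\<And>c. ring E c \<Longrightarrow> crossing_free E c"
  shows "\<exists>q. chordless q \<and> q \<noteq> [] \<and> 8 * (length c)\<^sup>2 \<le> 9 * 4 ^ length q \<and> set q \<subseteq> set c"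
proof -
  from ring_balanced_split[OF assms] obtain x ys z ws where r: "ring E (x # ys @ z # ws)"
    and set_c: "set (x # ys @ z # ws) = set c"
    and len: "length (x # ys @ z # ws) = length c" "length c \<le> 3 * Suc (length ys)"
      "3 * Suc (length ys) \<le> 2 * length c"
    and sep: "\<forall>y\<in>set ys. \<forall>w\<in>set ws. \<not> E y w" by blast
  have r2: "ring E (z # ws @ x # ys)" using ring_rotate[of "x # ys" "z # ws"] r by simp
  have dist: "distinct (x # ys @ z # ws)" using r by (simp add: ring_def)
  have w1: "successively E (x # ys @ [z])" "crossing_free E (x # ys @ [z])"
    using r cf[OF r] crossing_free_infix[of "[]" "x # ys @ [z]" ws]
    by (auto simp: ring_def successively_append_iff successively_Cons hd_append split: if_splits)
  have w2: "successively E (z # ws @ [x])" "crossing_free E (z # ws @ [x])"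
    using r2 cf[OF r2] crossing_free_infix[of "[]" "z # ws @ [x]" ys]
    by (auto simp: ring_def successively_append_iff successively_Cons hd_append split: if_splits)
  from wings[OF _ w1] dist obtain A B where AB: "chordless (x # A)" "chordless (z # B)"
    "set A \<subseteq> set ys" "set B \<subseteq> set ys" "Suc (length ys) \<le> 2 ^ (length A + length B)" by auto
  from wings[OF _ w2] dist obtain A' B' where AB': "chordless (z # A')" "chordless (x # B')"
    "set A' \<subseteq> set ws" "set B' \<subseteq> set ws" "Suc (length ws) \<le> 2 ^ (length A' + length B')" by auto
  have join: "chordless (rev P @ u # Q)" if "chordless (u # P)" "chordless (u # Q)"
    "set P \<subseteq> set ys" "set Q \<subseteq> set ws" for u P Q
  proof (rule chordless_join)
    show "chordless (rev P @ [u])" using chordless_rev[OF that(1)] by simp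
    show "set (rev P) \<inter> set Q = {}" using that dist by auto
    show "\<not> E a b" if "a \<in> set (rev P)" "b \<in> set Q" for a b
      using sep that \<open>set P \<subseteq> set ys\<close> \<open>set Q \<subseteq> set ws\<close> by auto
  qed fact
  have sub: "insert x (insert z (set A \<union> set B \<union> set A' \<union> set B')) \<subseteq> set c"
    unfolding set_c[symmetric] using AB(3,4) AB'(3,4) by auto
  \<comment> \<open>The paths glued at \<open>x\<close> and at \<open>z\<close> together use all
    four wings and two centres; the longer one has at least half of that total.\<close>
  obtain q where q: "chordless q" "q \<noteq> []" "set q \<subseteq> set c"
    and ql: "length A + length B + length A' + length B' + 2 \<le> 2 * length q"
  proof (cases "length A + length B' \<le> length B + length A'")
    case True
    then show ?thesis using that[OF join[OF AB(2) AB'(1)]] AB AB' sub by auto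
  next
    case False
    then show ?thesis using that[OF join[OF AB(1) AB'(2)]] AB AB' sub by auto
  qed
  let ?a = "Suc (length ys)" and ?b = "Suc (length ws)"
  have m: "length c = ?a + ?b" using len by simp
  \<comment> \<open>With \<open>a + b\<close> edges in all, both factors are nonnegative because
    \<open>a\<close> lies between one and two thirds of the total. Expanding gives
    \<open>2 (a + b)^2 <= 9 a b\<close>.\<close>
  have "0 \<le> (2 * int ?a - int ?b) * (2 * int ?b - int ?a)"
    using len(2,3) m by (intro mult_nonneg_nonneg) auto
  then have "8 * (int ?a + int ?b)\<^sup>2 \<le> 9 * (4 * (int ?a * int ?b))"
    by (simp add: power2_eq_square algebra_simps)
  then have "int (8 * (length c)\<^sup>2) \<le> int (9 * (4 * (?a * ?b)))"
    unfolding m by (simp only: of_nat_mult of_nat_add of_nat_power of_nat_numeral)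
  then have "8 * (length c)\<^sup>2 \<le> 9 * (4 * (?a * ?b))" by linarith
  also have "?a * ?b \<le> 2 ^ (length A + length B) * 2 ^ (length A' + length B')"
    using AB(5) AB'(5) by (rule mult_le_mono)
  also have "4 * \<dots> = 2 ^ (length A + length B + length A' + length B' + 2)"
    by (simp add: power_add)
  also have "\<dots> \<le> 2 ^ (2 * length q)" using ql by (rule power_increasing) simp
  finally have "8 * (length c)\<^sup>2 \<le> 9 * 4 ^ length q" by (simp add: power_mult)
  then show ?thesis using q by blast
qed

section \<open>Long paths force long rings\<close>

lemma ring_contains_segment:
  assumes "ring E c" "x \<in> set c" "z \<in> set c" "x \<noteq> z"
  obtains ys ws where "ring E (x # ys @ z # ws)" "set (x # ys @ z # ws) = set c"
    "length (x # ys @ z # ws) = length c"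
proof -
  obtain p q where c: "c = p @ x # q" using assms(2) by (meson split_list)
  then have r: "ring E (x # q @ p)" using ring_rotate assms(1) by fastforce
  have "z \<in> set (q @ p)" using assms c by auto
  then obtain ys ws where "q @ p = ys @ z # ws" by (meson split_list)
  moreover from this have "set q \<union> set p = insert z (set ys \<union> set ws)"
    "length q + length p = Suc (length ys + length ws)"
    by (metis set_append list.set(2) Un_insert_right, metis length_append length_Cons add_Suc_right)
  ultimately show ?thesis using that[of ys ws] r c by auto
qed

lemma ring_reroute:
  assumes "ring E (x # ys @ z # ws)" "successively E (x # as @ [z])" "distinct as"
    "set as \<inter> set (x # ys @ z # ws) = {}"
  shows "ring E (x # as @ z # ws)" "ring E (x # as @ z # rev ys)"
proof -
  have "successively E (rev ys)" if "successively E ys" for ys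
    using that unfolding successively_rev by (rule successively_mono) (auto dest: E_sym)
  then show "ring E (x # as @ z # ws)" "ring E (x # as @ z # rev ys)"
    using assms
    by (auto simp: ring_def successively_append_iff successively_Cons hd_append hd_rev last_rev
        dest: E_sym split: if_splits)
qed

text \<open>The visits of \<open>P\<close> to \<open>S\<close> cut it into one segment fewer than
  there are visits. \<open>B\<close> bounds twice the number of edges of a segment, which avoids
  halves.\<close>

lemma path_length_le_segments:
  assumes "distinct P" "successively E P" "P \<noteq> []" "hd P \<in> S" "last P \<in> S"
    and seg: "\<And>x as z. \<lbrakk>x \<in> S; z \<in> S; x \<noteq> z; set as \<inter> S = {}; distinct as;
        successively E (x # as @ [z])\<rbrakk> \<Longrightarrow> 2 * Suc (length as) \<le> (B :: nat)"
  shows "2 * (length P - 1) \<le> (card (set P \<inter> S) - 1) * B"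
  using assms(1-5)
proof (induction "length P" arbitrary: P rule: less_induct)
  case less
  obtain x P' where P: "P = x # P'" using less.prems by (cases P) auto
  show ?case
  proof (cases "P' = []")
    case False
    then have "\<exists>z\<in>set P'. z \<in> S" using less.prems P by (metis last_ConsR last_in_set)
    from split_list_first_prop[OF this]
    obtain as z bs where P': "P' = as @ z # bs" and z: "z \<in> S" and as: "\<forall>y\<in>set as. y \<notin> S" by blast
    have 1: "2 * Suc (length as) \<le> B"
      using less.prems P P' z as
      by (intro seg[of x z as]) (auto simp: successively_append_iff successively_Cons hd_append split: if_splits)
    have 2: "2 * (length (z # bs) - 1) \<le> (card (set (z # bs) \<inter> S) - 1) * B"
      using less.prems P P' z
      by (intro less.hyps) (auto simp: successively_append_iff successively_Cons hd_append split: if_splits)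
    have "set P \<inter> S = insert x (set (z # bs) \<inter> S)"
      using P P' as less.prems by auto
    moreover have "x \<notin> set (z # bs) \<inter> S" using less.prems P P' by auto
    moreover have "finite (set (z # bs) \<inter> S)" by simp
    ultimately have "card (set P \<inter> S) = Suc (card (set (z # bs) \<inter> S))" by simp
    moreover have "0 < card (set (z # bs) \<inter> S)" using z by (auto simp: card_gt_0_iff)
    ultimately have "card (set P \<inter> S) - 1 = Suc (card (set (z # bs) \<inter> S) - 1)" by linarith
    then show ?thesis using 1 2 P P' by simp
  qed (use P in simp)
qed

lemma path_length_le_ring_length:
  assumes P: "distinct P" "successively E P" "P \<noteq> []"
    and c: "ring E c" "hd P \<in> set c" "last P \<in> set c"
    and M: "\<And>c. ring E c \<Longrightarrow> length c \<le> M"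
  shows "2 * (length P - 1) \<le> M * (M - 1)"
proof -
  let ?y = "length c"
  have "2 * (length P - 1) \<le> (card (set P \<inter> set c) - 1) * (2 * M - ?y)"
  proof (rule path_length_le_segments[OF P c(2,3)])
    fix x as z
    assume a: "x \<in> set c" "z \<in> set c" "x \<noteq> z" "set as \<inter> set c = {}" "distinct as"
      "successively E (x # as @ [z])"
    from ring_contains_segment[OF c(1) a(1-3)] obtain ys ws where
      r: "ring E (x # ys @ z # ws)" "set (x # ys @ z # ws) = set c" "length (x # ys @ z # ws) = ?y" .
    \<comment> \<open>The two rerouted rings use each old arc once and the detour twice, so their
      lengths add up to \<open>length c + 2 * Suc (length as)\<close>.\<close>
    from ring_reroute[OF r(1) a(6,5)] a(4) r(2)
    have "length (x # as @ z # ws) \<le> M" "length (x # as @ z # rev ys) \<le> M"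
      using M by blast+
    then show "2 * Suc (length as) \<le> 2 * M - ?y" using r(3) by simp
  qed
  also have "\<dots> \<le> (?y - 1) * (2 * M - ?y)"
    by (intro mult_le_mono diff_le_mono order.refl order.trans[OF card_mono card_length]) auto
  also have "\<dots> \<le> M * (M - 1)"
  proof -
    have "2 \<le> ?y" using c(1) by (simp add: ring_def)
    moreover obtain d where d: "M = ?y + d" using M[OF c(1)] le_Suc_ex by blast
    ultimately obtain e where e: "?y = Suc e" by (cases ?y) auto
    \<comment> \<open>Here \<open>e\<close> is \<open>length c - 1\<close> and \<open>d\<close> is
      \<open>M - length c\<close>; the right side exceeds the left by
      \<open>d * (d + 1)\<close>.\<close>
    have "int e * (Suc e + 2 * d) \<le> int (Suc e + d) * (e + d)"
      by (simp add: algebra_simps)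
    then show ?thesis using d e by (simp add: algebra_simps)
  qed
  finally show ?thesis .
qed

text \<open>Induction along the path, with a ring through the start \<open>s\<close> and the current
  end \<open>u\<close>. For the next vertex \<open>v\<close>, a path from \<open>v\<close> to
  \<open>s\<close> that avoids \<open>u\<close> meets the ring first in some \<open>z\<close>. The
  detour from \<open>u\<close> over \<open>v\<close> to \<open>z\<close> replaces an arc of the
  ring.\<close>

lemma ends_on_common_ring:
  assumes conn: "\<And>u v w. \<lbrakk>u \<in> V; v \<in> V; w \<in> V; v \<noteq> u; w \<noteq> u\<rbrakk> \<Longrightarrow>
      \<exists>q. successively E q \<and> q \<noteq> [] \<and> hd q = v \<and> last q = w \<and> u \<notin> set q"
    and P: "distinct P" "successively E P" "2 \<le> length P" "set P \<subseteq> V"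
  shows "\<exists>c. ring E c \<and> hd P \<in> set c \<and> last P \<in> set c"
  using P
proof (induction P rule: rev_induct)
  case (snoc v P)
  show ?case
  proof (cases "length P = 1")
    case True
    then obtain s where "P = [s]" by (auto simp: length_Suc_conv)
    then show ?thesis using snoc.prems
      by (intro exI[of _ "[s, v]"]) (auto simp: ring_def dest: E_sym)
  next
    case False
    then have len: "2 \<le> length P" using snoc.prems by auto
    define s u where "s = hd P" and "u = last P"
    have P0: "P \<noteq> []" using len by auto
    obtain c where c: "ring E c" "s \<in> set c" "u \<in> set c"
      using snoc len by (auto simp: s_def u_def successively_append_iff)
    have uv: "E u v" using snoc.prems P0 by (auto simp: u_def successively_append_iff)
    have su: "s \<noteq> u" using len snoc.prems(1) unfolding s_def u_def
      by (cases P) (auto split: if_splits)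
    have V: "s \<in> V" "u \<in> V" "v \<in> V" "v \<noteq> u"
      using snoc.prems P0 by (auto simp: s_def u_def)
    show ?thesis
    proof (cases "v \<in> set c")
      case True
      then show ?thesis using c P0 s_def by auto
    next
      case vc: False
      obtain q0 where "successively E q0" "q0 \<noteq> []" "hd q0 = v" "last q0 = s" "u \<notin> set q0"
        using conn[of u v s] V su by blast
      \<comment> \<open>Shortcutting removes repeated vertices, so that the detour can be part of a
        ring.\<close>
      then obtain q where q: "chordless q" "q \<noteq> []" "hd q = v" "last q = s" "u \<notin> set q"
        using chordless_shortcut by blast
      have "\<exists>z\<in>set q. z \<in> set c" using q c by (metis last_in_set)
      from split_list_first_prop[OF this]
      obtain as z bs where sp: "q = as @ z # bs" "z \<in> set c" "\<forall>y\<in>set as. y \<notin> set c" by blast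
      have as0: "as \<noteq> []" "hd as = v" using sp q vc by (cases as; auto)+
      have "z \<noteq> u" using sp q by auto
      from ring_contains_segment[OF c(1) c(3) sp(2)] this obtain ys ws where
        r: "ring E (u # ys @ z # ws)" "set (u # ys @ z # ws) = set c" by metis
      have "successively E (u # as @ [z])"
        using chordless_successively[OF q(1)] sp as0 uv
        by (auto simp: successively_append_iff successively_Cons hd_append)
      moreover have "distinct as" using chordless_distinct[OF q(1)] sp by simp
      moreover have "set as \<inter> set (u # ys @ z # ws) = {}" using sp r by auto
      ultimately have "ring E (u # as @ z # ws)" "ring E (u # as @ z # rev ys)"
        using ring_reroute[OF r(1)] by blast+
      \<comment> \<open>Since \<open>s\<close> differs from \<open>u\<close>, one of the two
        rerouted rings keeps it.\<close>
      moreover have "s \<in> set (z # ws) \<or> s \<in> set (rev ys)" using r(2) c(2) su by auto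
      moreover have "v \<in> set as" using as0 by (metis hd_in_set)
      moreover have "hd (P @ [v]) = s" "last (P @ [v]) = v" using P0 s_def by auto
      ultimately show ?thesis by (metis Un_iff list.set_intros(2) set_append set_ConsD)
    qed
  qed
qed simp

section \<open>Crossing chords under deletion of a degree-two vertex\<close>

lemma ring_has_neighbor:
  assumes "ring E c" "x \<in> set c"
  shows "\<exists>y. E x y"
proof -
  obtain p q where c: "c = p @ x # q" using assms(2) by (meson split_list)
  then have "ring E (x # q @ p)" using ring_rotate assms(1) by fastforce
  then show ?thesis unfolding ring_def by (cases "q @ p") auto
qed

text \<open>By repeated rotation any of the four sections of the ring becomes the last one.\<close>

lemma crossing_rotate:
  assumes "ring E (a # xs @ b # ys @ c # zs @ d # ws)" "E a c" "E b d"
  shows "ring E (b # ys @ c # zs @ d # ws @ a # xs)" "E b d" "E c a"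
  using ring_rotate[of "a # xs" "b # ys @ c # zs @ d # ws"] assms by (auto dest: E_sym)

text \<open>As at least two other vertices remain, the two ring neighbours of \<open>v\<close> are
  distinct. Hence they are \<open>s\<close> and \<open>t\<close>, and their edge closes the
  gap.\<close>

lemma ring_delete:
  assumes r: "ring E (p @ v # q)" and len: "2 \<le> length (p @ q)"
    and v: "{u. E v u} = {s, t}" "E s t"
  shows "ring E (p @ q)"
proof -
  define r where "r = q @ p"
  have vr: "ring E (v # r)" using ring_rotate[OF assms(1)] by (simp add: r_def)
  have rlen: "2 \<le> length r" using len by (simp add: r_def)
  then have r0: "r \<noteq> []" by auto
  have "E v (hd r)" "E v (last r)"
    using vr r0 by (auto simp: ring_def successively_Cons dest: E_sym)
  then have "hd r \<in> {s, t}" "last r \<in> {s, t}" using v(1) by blast+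
  moreover have "hd r \<noteq> last r"
    using vr rlen by (cases r) (auto simp: ring_def split: if_splits)
  ultimately have "E (last r) (hd r)" using v(2) E_sym by auto
  then have "ring E r" using vr rlen r0 by (auto simp: ring_def successively_Cons)
  then show ?thesis using ring_rotate by (simp add: r_def)
qed

text \<open>The two ring neighbours of \<open>d\<close> and the vertex \<open>b\<close> would be
  three distinct vertices in \<open>{s, t}\<close>. The ring neighbours could coincide only if
  \<open>b\<close> were the sole other vertex.\<close>

lemma chord_end_degree:
  assumes "ring E (p @ d # q)" "E d b" "{u. E d u} = {s, t}" "p \<noteq> []" "b \<in> set p" "b \<noteq> last p"
    "b \<noteq> hd (q @ p)"
  shows False
proof -
  define r where "r = q @ p"
  have dr: "ring E (d # r)" using ring_rotate[OF assms(1)] by (simp add: r_def)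
  have r0: "r \<noteq> []" and last: "last r = last p" using assms(4) by (auto simp: r_def)
  have "E d (hd r)" "E d (last r)"
    using dr r0 by (auto simp: ring_def successively_Cons dest: E_sym)
  then have "{hd r, last r, b} \<subseteq> {s, t}" using assms(2,3) by blast
  moreover have "hd r \<noteq> last r"
  proof
    assume eq: "hd r = last r"
    have "distinct r" using dr by (simp add: ring_def)
    with eq r0 have "r = [hd r]" by (cases r) (auto split: if_splits)
    then have "set r = {hd r}" by (metis list.set(1,2))
    then show False using assms(5,7) by (auto simp: r_def)
  qed
  ultimately show False using assms(6,7) last by (auto simp: r_def)
qed

lemma crossing_bypass:
  assumes r: "ring E (a # xs @ b # ys @ c # zs @ d # ws)" and ch: "E a c" "E b d"
    and v: "{u. E v u} = {p, q}" "E p q" and vin: "v \<in> set (d # ws)"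
  shows "\<exists>ws'. ring (\<lambda>x y. E x y \<and> x \<noteq> v \<and> y \<noteq> v) (a # xs @ b # ys @ c # zs @ d # ws')
           \<and> v \<notin> {a, b, c, d}"
proof -
  have dist: "distinct (a # xs @ b # ys @ c # zs @ d # ws)" using r by (simp add: ring_def)
  have "v \<noteq> d"
  proof
    assume "v = d"
    let ?p = "a # xs @ b # ys @ c # zs"
    \<comment> \<open>On the ring, \<open>b\<close> is separated from \<open>d\<close> by
      \<open>c\<close> on one side and by \<open>a\<close> on the other.\<close>
    have "last ?p \<in> set (c # zs)" using last_in_set[of "c # zs"] by simp
    then have "b \<noteq> last ?p" using dist by auto
    moreover have "hd (ws @ ?p) \<in> set (ws @ [a])" by (cases ws) auto
    then have "b \<noteq> hd (ws @ ?p)" using dist by auto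
    ultimately show False
      using chord_end_degree[of ?p d ws b p q] r ch(2) v(1) \<open>v = d\<close> E_sym by auto
  qed
  then obtain w1 w2 where ws: "ws = w1 @ v # w2" using vin by (auto dest: split_list)
  let ?c = "a # xs @ b # ys @ c # zs @ d # w1 @ w2"
  have vnot: "v \<notin> set ?c" using dist ws by auto
  have "ring E ?c"
    using ring_delete[of "a # xs @ b # ys @ c # zs @ d # w1" v w2 p q] r v ws by simp
  then have "ring (\<lambda>x y. E x y \<and> x \<noteq> v \<and> y \<noteq> v) ?c"
    using vnot by (elim ring_mono) metis
  then show ?thesis using vnot by auto
qed

text \<open>\<open>F\<close> is adjacency after removing \<open>v\<close>, as in the recursion of
  2-trees. The rotations \<open>r1\<close>, \<open>r2\<close>, \<open>r3\<close> bring the sections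
  of \<open>a\<close>, \<open>b\<close>, \<open>c\<close> to the end, where
  \<open>crossing_bypass\<close> applies.\<close>

lemma crossing_delete:
  assumes r: "ring E (a # xs @ b # ys @ c # zs @ d # ws)" "E a c" "E b d"
    and v: "{u. E v u} = {p, q}" "E p q"
  defines "F \<equiv> \<lambda>x y. E x y \<and> x \<noteq> v \<and> y \<noteq> v"
  shows "\<exists>a xs b ys c zs d ws. ring F (a # xs @ b # ys @ c # zs @ d # ws) \<and> F a c \<and> F b d"
proof (cases "v \<in> set (a # xs @ b # ys @ c # zs @ d # ws)")
  case False
  have "ring F (a # xs @ b # ys @ c # zs @ d # ws)"
    using r(1) False unfolding F_def by (elim ring_mono) metis
  moreover have "F a c" "F b d" using r(2,3) False by (auto simp: F_def)
  ultimately show ?thesis by blast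
next
  case True
  note r1 = crossing_rotate[OF r]
  note r2 = crossing_rotate[OF r1]
  note r3 = crossing_rotate[OF r2]
  from True consider "v \<in> set (a # xs)" | "v \<in> set (b # ys)" | "v \<in> set (c # zs)" | "v \<in> set (d # ws)"
    by auto
  then show ?thesis
  proof cases
    case 1
    then show ?thesis using crossing_bypass[OF r1 v] r1 unfolding F_def by blast
  next
    case 2
    then show ?thesis using crossing_bypass[OF r2 v] r2 unfolding F_def by blast
  next
    case 3
    then show ?thesis using crossing_bypass[OF r3 v] r3 unfolding F_def by blast
  next
    case 4
    then show ?thesis using crossing_bypass[OF r v] r unfolding F_def by blast
  qed
qed

end

section \<open>Absence of crossing chords in partial 2-trees\<close>

lemma pair_graph_symmetric_relation:
  assumes "pair_graph G"
  shows "symmetric_relation (\<lambda>x y. (x, y) \<in> parcs G)"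
proof -
  interpret pair_graph G by fact
  show ?thesis
    using pair_sym_arcs by unfold_locales (auto simp: symmetric_def dest: symD)
qed

text \<open>The vertex added last has two adjacent neighbours, so a crossing pair survives its
  removal. A clique on two vertices is too small for one.\<close>

lemma two_tree_no_crossing:
  assumes "k_tree 2 T" "ring (\<lambda>x y. (x, y) \<in> parcs T) (a # xs @ b # ys @ c # zs @ d # ws)"
    "(a, c) \<in> parcs T" "(b, d) \<in> parcs T"
  shows False
  using assms
proof (induction arbitrary: a xs b ys c zs d ws rule: k_tree.induct)
  case (clique T)
  then have "finite (pverts T)" "card (pverts T) = 2" "{a, b, c} \<subseteq> pverts T"
    by (auto simp: complete_digraph_pair_def)
  moreover have "card {a, b, c} = 3" using clique.prems(1) by (auto simp: ring_def)
  ultimately show False using card_mono[of "pverts T" "{a, b, c}"] by simp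
next
  case (extend T v)
  interpret pair_graph T by fact
  interpret symmetric_relation "\<lambda>x y. (x, y) \<in> parcs T"
    by (rule pair_graph_symmetric_relation) fact
  have N: "neighborhood T v \<subseteq> pverts T"
    using arc_snd_in_verts by (fastforce simp: neighborhood_def)
  have "card (pverts T \<inter> neighborhood T v) = 2"
    and cl: "parcs T \<inter> neighborhood T v \<times> neighborhood T v =
      {(x, y). x \<in> pverts T \<inter> neighborhood T v \<and> y \<in> pverts T \<inter> neighborhood T v \<and> x \<noteq> y}"
    using extend.hyps(3) by (auto simp: complete_digraph_pair_def induced_pair_def)
  then obtain p q where pq: "neighborhood T v = {p, q}" "p \<noteq> q"
    using N by (auto simp: card_2_iff Int_absorb1)
  have "(p, q) \<in> parcs T" using cl pq N by auto
  moreover have "{u. (v, u) \<in> parcs T} = {p, q}" using pq by (simp add: neighborhood_def)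
  ultimately obtain a xs b ys c zs d ws where
    r: "ring (\<lambda>x y. (x, y) \<in> parcs T \<and> x \<noteq> v \<and> y \<noteq> v) (a # xs @ b # ys @ c # zs @ d # ws)"
    and ch: "(a, c) \<in> parcs T \<and> a \<noteq> v \<and> c \<noteq> v" "(b, d) \<in> parcs T \<and> b \<noteq> v \<and> d \<noteq> v"
    using crossing_delete[OF extend.prems] by blast
  show False
  proof (rule extend.IH)
    show "ring (\<lambda>x y. (x, y) \<in> parcs (induced_pair T (- {v}))) (a # xs @ b # ys @ c # zs @ d # ws)"
      using r by (rule ring_mono) (simp add: induced_pair_def)
    show "(a, c) \<in> parcs (induced_pair T (- {v}))" "(b, d) \<in> parcs (induced_pair T (- {v}))"
      using ch by (simp_all add: induced_pair_def)
  qed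
qed

lemma partial_k_tree_embedding:
  assumes "partial_k_tree k G"
  obtains T :: "nat pair_pre_digraph" and f
  where "k_tree k T" "inj_on f (pverts G)"
    "\<And>x y. (x, y) \<in> parcs G \<Longrightarrow> (f x, f y) \<in> parcs T"
proof -
  obtain T H :: "nat pair_pre_digraph" and h where T: "k_tree k T"
    and sub: "subgraph (with_proj H) (with_proj T)"
    and iso: "pre_digraph.digraph_isomorphism (with_proj G) h" "with_proj H = app_iso h (with_proj G)"
    using assms unfolding partial_k_tree_def digraph_iso_def by blast
  have "(iso_verts h x, iso_verts h y) \<in> parcs T" if e: "(x, y) \<in> parcs G" for x y
  proof -
    have "arcs (with_proj H) = iso_arcs h ` arcs (with_proj G)"
      "tail (with_proj H) = iso_tail h" "head (with_proj H) = iso_head h"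
      unfolding iso(2) by (simp_all add: arcs_app_iso tail_app_iso head_app_iso)
    \<comment> \<open>Tails and heads are the two projections in both graphs, so the arc map acts
      componentwise as the vertex map.\<close>
    then have "iso_arcs h (x, y) \<in> parcs H" "iso_tail h = fst" "iso_head h = snd"
      using e by auto
    moreover have "iso_verts h x = iso_tail h (iso_arcs h (x, y))"
      "iso_verts h y = iso_head h (iso_arcs h (x, y))"
      using iso(1) e unfolding pre_digraph.digraph_isomorphism_def by auto
    ultimately have "(iso_verts h x, iso_verts h y) \<in> parcs H" by simp
    then show ?thesis using sub by (auto simp: subgraph_def)
  qed
  moreover have "inj_on (iso_verts h) (pverts G)"
    using iso(1) unfolding pre_digraph.digraph_isomorphism_def by simp
  ultimately show ?thesis using that T by blast
qed

lemma partial_two_tree_crossing_free: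
  assumes "pair_graph G" "partial_k_tree 2 G" and r: "ring (\<lambda>x y. (x, y) \<in> parcs G) w"
  shows "crossing_free (\<lambda>x y. (x, y) \<in> parcs G) w"
proof -
  interpret pair_graph G by fact
  interpret symmetric_relation "\<lambda>x y. (x, y) \<in> parcs G"
    by (rule pair_graph_symmetric_relation) fact
  obtain T :: "nat pair_pre_digraph" and f where T: "k_tree 2 T" "inj_on f (pverts G)"
    "\<And>x y. (x, y) \<in> parcs G \<Longrightarrow> (f x, f y) \<in> parcs T"
    using partial_k_tree_embedding[OF assms(2)] by metis
  have map: "ring (\<lambda>x y. (x, y) \<in> parcs T) (map f w)" if "ring (\<lambda>x y. (x, y) \<in> parcs G) w" for w
  proof -
    have "set w \<subseteq> pverts G" using ring_has_neighbor[OF that] arc_fst_in_verts by fastforce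
    then have "distinct (map f w)"
      using that T(2) by (auto simp: ring_def distinct_map intro: inj_on_subset)
    moreover have "w \<noteq> []" using that by (auto simp: ring_def)
    moreover have "ring (\<lambda>x y. (f x, f y) \<in> parcs T) w" using that T(3) by (rule ring_mono)
    ultimately show ?thesis
      by (simp add: ring_def successively_map last_map hd_map)
  qed
  show ?thesis unfolding crossing_free_def
  proof (intro allI impI notI, elim conjE)
    fix p a xs b ys c zs d ws
    assume w: "w = p @ a # xs @ b # ys @ c # zs @ d # ws"
      and "(a, c) \<in> parcs G" "(b, d) \<in> parcs G"
    \<comment> \<open>Moving the prefix \<open>p\<close> to the end makes the ring start at a chord
      end.\<close>
    have "ring (\<lambda>x y. (x, y) \<in> parcs G) (a # xs @ b # ys @ c # zs @ d # ws @ p)"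
      using ring_rotate[of p "a # xs @ b # ys @ c # zs @ d # ws"] r w by simp
    from map[OF this] show False
      using two_tree_no_crossing[OF T(1), of "f a" "map f xs" "f b" "map f ys" "f c" "map f zs" "f d"
          "map f (ws @ p)"] T(3) \<open>(a, c) \<in> parcs G\<close> \<open>(b, d) \<in> parcs G\<close> by simp
  qed
qed

section \<open>2-connectivity and the final bound\<close>

lemma two_connected_avoiding_path:
  assumes "pair_graph G" "k_connected 2 G"
    and "u \<in> pverts G" "v \<in> pverts G" "w \<in> pverts G" "v \<noteq> u" "w \<noteq> u"
  shows "\<exists>q. successively (\<lambda>x y. (x, y) \<in> parcs G) q \<and> q \<noteq> [] \<and> hd q = v \<and> last q = w \<and> u \<notin> set q"
proof -
  interpret pair_graph G by fact
  interpret symmetric_relation "\<lambda>x y. (x, y) \<in> parcs G"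
    by (rule pair_graph_symmetric_relation) fact
  let ?H = "induced_pair G (- {u})"
  have "connected (with_proj ?H)"
    using assms(2,3) unfolding k_connected_def by auto
  moreover have "v \<in> pverts ?H" "w \<in> pverts ?H" using assms by (auto simp: induced_pair_def)
  ultimately have "(v, w) \<in> rtrancl_on (pverts ?H) ((parcs ?H)\<^sup>s)"
    by (simp add: connected_conv)
  then show ?thesis
  proof (induction rule: rtrancl_on_induct)
    case base
    then show ?case by (intro exI[of _ "[v]"]) (auto simp: induced_pair_def)
  next
    case (step y z)
    then obtain q where "successively (\<lambda>x y. (x, y) \<in> parcs G) q" "q \<noteq> []" "hd q = v" "last q = y" "u \<notin> set q"
      by blast
    moreover have "(y, z) \<in> parcs G" "z \<noteq> u" using step by (auto simp: induced_pair_def symcl_def dest: E_sym)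
    ultimately show ?case
      by (intro exI[of _ "q @ [z]"]) (auto simp: successively_append_iff)
  qed
qed

lemma successively_arcs_iff:
  "successively (\<lambda>x y. (x, y) \<in> A) p \<longleftrightarrow> set (vwalk_arcs p) \<subseteq> A"
  by (induction p rule: vwalk_arcs.induct) auto

theorem theorem5:
  fixes G :: "'a pair_pre_digraph" and n :: nat
  assumes "pair_graph G"
    and "k_connected 2 G"
    and "partial_k_tree 2 G"
    and "n > 3"
    and "\<exists>p. vpath p (with_proj G) \<and> length p = n"
  shows "\<exists>q. induced_vpath q G \<and> real (length q) \<ge> log 2 (real n - 3) / 2"
proof -
  interpret pair_graph G by fact
  let ?E = "\<lambda>x y. (x, y) \<in> parcs G"
  interpret symmetric_relation ?E
    by (rule pair_graph_symmetric_relation) fact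
  obtain P where P: "distinct P" "successively ?E P" "P \<noteq> []" "set P \<subseteq> pverts G" "length P = n"
    using assms(5) by (auto simp: vpath_def vwalk_def successively_arcs_iff)
  have in_verts: "set c \<subseteq> pverts G" if "ring ?E c" for c
    using ring_has_neighbor[OF that] arc_fst_in_verts by fastforce
  obtain c where c: "ring ?E c" "hd P \<in> set c" "last P \<in> set c"
    using ends_on_common_ring[OF two_connected_avoiding_path[OF assms(1,2)] P(1,2) _ P(4)] P(5) assms(4)
    by auto
  \<comment> \<open>Ring lengths are bounded by the number of vertices, so a longest ring
    exists.\<close>
  have "length c < Suc (card (pverts G))" if "ring ?E c" for c
    using card_mono[OF pair_finite_verts in_verts[OF that]] that
    by (simp add: ring_def distinct_card)
  then obtain m where m: "ring ?E m" and max: "\<And>c. ring ?E c \<Longrightarrow> length c \<le> length m"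
    using ex_has_greatest_nat[of "ring ?E" c length] c(1) by metis
  obtain q where q: "chordless q" "q \<noteq> []" "8 * (length m)\<^sup>2 \<le> 9 * 4 ^ length q"
      "set q \<subseteq> set m"
    using ring_chordless_path[OF m partial_two_tree_crossing_free[OF assms(1,3)]] by blast
  have "2 * (n - 1) \<le> length m * (length m - 1)"
    using path_length_le_ring_length[OF P(1-3) c max] P(5) by simp
  also have "\<dots> \<le> (length m)\<^sup>2" by (simp add: power2_eq_square)
  \<comment> \<open>With \<open>s = length q\<close>, combining \<open>2 (n - 1) <= M^2\<close> and
    \<open>8 M^2 <= 9 * 4^s\<close> gives \<open>16 (n - 1) <= 9 * 4^s\<close>, which is more than
    enough.\<close>
  finally have "n - 3 \<le> 4 ^ length q" using q(3) by linarith
  then have "real (n - 3) \<le> real (4 ^ length q)" by (rule of_nat_mono)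
  then have "real n - 3 \<le> 2 powr (2 * real (length q))"
    using assms(4) by (simp add: powr_powr[symmetric] powr_realpow of_nat_diff)
  then have "log 2 (real n - 3) \<le> 2 * real (length q)"
    using assms(4) by (subst log_le_iff) auto
  moreover have "induced_vpath q G"
  proof -
    have arcs: "set (vwalk_arcs q) \<subseteq> parcs G"
      using chordless_successively[OF q(1)] by (simp add: successively_arcs_iff)
    have "set q \<subseteq> pverts G" using q(4) in_verts[OF m] by blast
    then have "vpath q (with_proj G)"
      using arcs q chordless_distinct by (auto simp: vpath_def vwalk_def)
    moreover have "set (vwalk_arcs q) \<subseteq> set q \<times> set q"
      by (induction q rule: vwalk_arcs.induct) auto
    then have "set (vwalk_arcs q) \<union> (set (vwalk_arcs q))\<inverse> \<subseteq> parcs G \<inter> set q \<times> set q"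
      using arcs E_sym by auto
    \<comment> \<open>\<open>chordless\<close> leaves loops open; the graph itself excludes
      them.\<close>
    moreover have "parcs G \<inter> set q \<times> set q \<subseteq> set (vwalk_arcs q) \<union> (set (vwalk_arcs q))\<inverse>"
      using chordless_arcs[OF q(1)] pair_no_loops by fastforce
    ultimately show ?thesis
      unfolding induced_vpath_def induced_pair_def by auto
  qed
  ultimately show ?thesis by auto
qed

end
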